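(* Let $k>\ell\ge 1$ be integers and let $q\ge 1$ be an integer. Then there exists a $k$-graph $F$ (with at least one edge) such that \[\gamma^{(k)}_\ell(F)=1-q^{\ell-k}.\]
   Context: A $k$-graph is a pair $H=(V,E)$ with $V$ a finite set and $E\subseteq\binom{V}{k}$. For $0<\ell<k$ and $T\in\binom{V(H)}{\ell}$, the degree $d_H(T)$ is the number of $(k-\ell)$-sets $T'\subseteq V(H)\setminus T$ with $T\cup T'\in E(H)$; the minimum $\ell$-degree is $\delta_\ell(H)=\min\{d_H(T):T\in\binom{V(H)}{\ell}\}$. For a $k$-graph $F$ with at least one edge, a $k$-graph is $F$-free if it does not contain $F$ as a (not necessarily induced) subgraph. Let $\mathrm{ex}^{(k)}_\ell(n,F)$ be the maximum of $\delta_\ell(H)$ over all $n$-vertex $F$-free $k$-graphs $H$. The $\ell$-degree Turán density is \[\gamma^{(k)}_\ell(F)=\lim_{n\to\infty}\frac{\mathrm{ex}^{(k)}_\ell(n,F)}{\binom{n-\ell}{k-\ell}},\] and this limit is known to exist. *)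

theory Defs
  imports Complex_Main
begin

(* A hypergraph is a pair of a vertex set and an edge set. *)
type_synonym 'a hgraph = "'a set \<times> 'a set set"

abbreviation verts :: "'a hgraph \<Rightarrow> 'a set" where "verts \<equiv> fst"
abbreviation edges :: "'a hgraph \<Rightarrow> 'a set set" where "edges \<equiv> snd"

definition k_graph :: "nat \<Rightarrow> 'a hgraph \<Rightarrow> bool" where
  "k_graph k H \<longleftrightarrow> finite (verts H) \<and> edges H \<subseteq> {e. e \<subseteq> verts H \<and> card e = k}"

definition degree :: "nat \<Rightarrow> 'a hgraph \<Rightarrow> 'a set \<Rightarrow> nat" where
  "degree k H T = card {T'. T' \<subseteq> verts H - T \<and> card T' = k - card T \<and> T \<union> T' \<in> edges H}"

(* Min is unspecified on the empty set, i.e. when H has fewer than l vertices.  This concerns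
   only finitely many n and so does not affect the Turan density. *)
definition min_degree :: "nat \<Rightarrow> nat \<Rightarrow> 'a hgraph \<Rightarrow> nat" where
  "min_degree k l H = Min (degree k H ` {T. T \<subseteq> verts H \<and> card T = l})"

definition contains_copy :: "'a hgraph \<Rightarrow> 'b hgraph \<Rightarrow> bool" where
  "contains_copy H F \<longleftrightarrow>
     (\<exists>f. inj_on f (verts F) \<and> f ` verts F \<subseteq> verts H \<and> (\<forall>e\<in>edges F. f ` e \<in> edges H))"

definition free_of :: "'b hgraph \<Rightarrow> 'a hgraph \<Rightarrow> bool" where
  "free_of F H \<longleftrightarrow> \<not> contains_copy H F"

(* The host graphs H have vertices in nat; every finite hypergraph is isomorphic to such a one.
   When F has an edge and n \<ge> l, the set below is finite (degrees are bounded)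
   and nonempty (it contains the value for the edgeless hypergraph), so Max is the maximum. *)
definition ex_degree :: "nat \<Rightarrow> nat \<Rightarrow> nat \<Rightarrow> 'b hgraph \<Rightarrow> nat" where
  "ex_degree k l n F =
     Max {min_degree k l H | H :: nat hgraph. k_graph k H \<and> card (verts H) = n \<and> free_of F H}"

definition degree_ratio :: "nat \<Rightarrow> nat \<Rightarrow> 'b hgraph \<Rightarrow> nat \<Rightarrow> real" where
  "degree_ratio k l F n = real (ex_degree k l n F) / real ((n - l) choose (k - l))"

definition turan_density :: "nat \<Rightarrow> nat \<Rightarrow> 'b hgraph \<Rightarrow> real" where
  "turan_density k l F = lim (degree_ratio k l F)"

end

theory Submission
  imports Defs
begin

text \<open>
  Write \<open>r = k - l\<close>. The extremal hosts are the hypergraphs of all non-monochromatic \<open>k\<close>-sets of a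
  vertex set split into \<open>q\<close> equal classes. An \<open>l\<close>-set \<open>T\<close> inside one class lacks only the \<open>r\<close>-sets
  inside that class, a fraction \<open>q^(-r)\<close> of all \<open>r\<close>-sets, and every other \<open>l\<close>-set lacks nothing. Such
  a host contains no \<open>F\<close> that is \<^emph>\<open>uncolourable\<close>, that is, has a monochromatic edge under every
  \<open>q\<close>-colouring of its vertices (lemma \<open>ex_degree_lower\<close>). It remains to find an uncolourable \<open>F\<close> that
  every large host of relative minimum \<open>l\<close>-degree above \<open>1 - q^(-r)\<close> must contain.

  Let \<open>d = q^(-r)\<close>. In such a host any \<open>q\<close> of the \<open>l\<close>-sets are joined simultaneously to more than a
  fraction \<open>1 - q * d = 1 - q^(1-r)\<close> of the \<open>r\<close>-sets. Suppose that an uncolourable \<open>r\<close>-graph \<open>F'\<close> is known that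
  occurs in every large \<open>r\<close>-graph of edge density above \<open>1 - q^(1-r)\<close>. Then a copy of \<open>F'\<close> can be found in the
  common link of the \<open>q\<close> given \<open>l\<close>-sets, away from any bounded set of vertices (\<open>forces_glue\<close>). So,
  starting from the empty hypergraph, one may repeatedly attach a new copy of \<open>F'\<close> to every family
  of at most \<open>q\<close> of the \<open>l\<close>-sets present, and the result still occurs in all these hosts. Consider a
  \<open>q\<close>-colouring without monochromatic edge, and for every colour used on at least \<open>l\<close> vertices choose
  an \<open>l\<close>-set of that colour. The copy of \<open>F'\<close> attached to the chosen sets has a monochromatic edge,
  and its colour is none of those already used \<open>l\<close> times, as otherwise that edge and the \<open>l\<close>-set of the same
  colour would form a monochromatic \<open>k\<close>-edge. Hence each round adds a vertex in a colour used fewer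
  than \<open>l\<close> times, which is possible at most \<open>q * l\<close> times; after \<open>q * l + 1\<close> rounds no such
  colouring exists (\<open>exists_uncolourable_degree_forced\<close>).

  The graphs \<open>F'\<close> come from the same construction by induction on \<open>r\<close>
  (\<open>exists_uncolourable_density_forced\<close>). For \<open>r = 1\<close> a single vertex that is an edge will do. The
  construction with \<open>l = 1\<close> turns the \<open>r\<close>-graph into an uncolourable \<open>(r+1)\<close>-graph forced by relative minimum degree
  above \<open>1 - q^(-r)\<close>, and an edge density above this bound suffices as well, because a graph of that
  density has a large induced subgraph of that minimum degree (\<open>forces_density_of_forces_degree\<close>).
\<close>

section \<open>Asymptotics of binomial coefficients\<close>

lemma choose_over_power_tendsto:
  fixes x :: "nat \<Rightarrow> nat"
  assumes "(\<lambda>n. real (x n) / real n) \<longlonglongrightarrow> c"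
  shows "(\<lambda>n. real (x n choose r) / real n ^ r) \<longlonglongrightarrow> c ^ r / fact r"
proof -
  have "(\<lambda>n. (\<Prod>i<r. (real (x n) - real i) / real n) / fact r) \<longlonglongrightarrow> (\<Prod>i<r. c) / fact r"
  proof (intro tendsto_divide tendsto_prod tendsto_const)
    fix i
    have "(\<lambda>n. real (x n) / real n - real i * (1 / real n)) \<longlonglongrightarrow> c - real i * 0"
      by (intro tendsto_intros assms lim_1_over_n)
    then show "(\<lambda>n. (real (x n) - real i) / real n) \<longlonglongrightarrow> c"
      by (simp add: diff_divide_distrib)
  qed simp
  moreover have "(\<Prod>i<r. (real (x n) - real i) / real n) / fact r
      = real (x n choose r) / real n ^ r" for n
    by (simp add: binomial_gbinomial gbinomial_prod_rev prod_dividef atLeast0LessThan)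
  ultimately show ?thesis by simp
qed

lemma choose_ratio_tendsto:
  fixes x y :: "nat \<Rightarrow> nat"
  assumes "(\<lambda>n. real (x n) / real n) \<longlonglongrightarrow> c" "(\<lambda>n. real (y n) / real n) \<longlonglongrightarrow> 1"
  shows "(\<lambda>n. real (x n choose r) / real (y n choose r)) \<longlonglongrightarrow> c ^ r"
proof -
  have "(\<lambda>n. (real (x n choose r) / real n ^ r) / (real (y n choose r) / real n ^ r))
      \<longlonglongrightarrow> (c ^ r / fact r) / (1 ^ r / fact r)"
    by (intro tendsto_divide choose_over_power_tendsto assms) simp
  then have "(\<lambda>n. (real (x n choose r) / real n ^ r) / (real (y n choose r) / real n ^ r)) \<longlonglongrightarrow> c ^ r"
    by simp
  then show ?thesis
    by (rule Lim_transform_eventually)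
      (use eventually_gt_at_top[of 0] in \<open>eventually_elim, simp\<close>)
qed

lemma shift_ratio_tendsto: "(\<lambda>n. real (n - u) / real n) \<longlonglongrightarrow> 1"
proof -
  have "(\<lambda>n. 1 - real u * (1 / real n)) \<longlonglongrightarrow> 1 - real u * 0"
    by (intro tendsto_intros lim_1_over_n)
  then have "(\<lambda>n. 1 - real u * (1 / real n)) \<longlonglongrightarrow> 1" by simp
  then show ?thesis
    by (rule Lim_transform_eventually)
      (use eventually_gt_at_top[of u] in \<open>eventually_elim, simp add: field_simps\<close>)
qed

lemma choose_at_top:
  assumes "k \<ge> 1"
  shows "filterlim (\<lambda>n. real (n choose k)) at_top sequentially"
proof -
  have 1: "filterlim (\<lambda>n. real n ^ k) at_top sequentially"
    using assms by (intro filterlim_pow_at_top filterlim_real_sequentially) auto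
  have "(\<lambda>n. real n / real n) \<longlonglongrightarrow> 1" using shift_ratio_tendsto[of 0] by simp
  from choose_over_power_tendsto[OF this, of k]
  have 2: "(\<lambda>n. real (n choose k) / real n ^ k) \<longlonglongrightarrow> 1 / fact k" by simp
  have "filterlim (\<lambda>n. (real (n choose k) / real n ^ k) * real n ^ k) at_top sequentially"
    by (rule filterlim_tendsto_pos_mult_at_top[OF 2 _ 1]) simp
  then show ?thesis
    by (rule filterlim_mono_eventually)
      (auto intro: eventually_mono[OF eventually_gt_at_top[of 0]])
qed

section \<open>Hypergraphs forced by large degrees\<close>

lemma degree_plus_missing:
  assumes "k_graph k H" "T \<subseteq> verts H"
  shows "degree k H T + card {S. S \<subseteq> verts H - T \<and> card S = k - card T \<and> T \<union> S \<notin> edges H}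
    = (card (verts H) - card T) choose (k - card T)"
proof -
  have fin: "finite (verts H)" using assms by (simp add: k_graph_def)
  then have finT: "finite T" using assms finite_subset by blast
  have fin2: "finite {S. S \<subseteq> verts H - T \<and> P S}" for P
    by (rule finite_subset[of _ "Pow (verts H)"]) (use fin in auto)
  have "{S. S \<subseteq> verts H - T \<and> card S = k - card T}
     = {S. S \<subseteq> verts H - T \<and> card S = k - card T \<and> T \<union> S \<in> edges H}
      \<union> {S. S \<subseteq> verts H - T \<and> card S = k - card T \<and> T \<union> S \<notin> edges H}" by auto
  then have "card {S. S \<subseteq> verts H - T \<and> card S = k - card T} = degree k H T
     + card {S. S \<subseteq> verts H - T \<and> card S = k - card T \<and> T \<union> S \<notin> edges H}"
    unfolding degree_def by (simp only:) (rule card_Un_disjoint, auto intro: fin2)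
  moreover have "card {S. S \<subseteq> verts H - T \<and> card S = k - card T}
    = (card (verts H) - card T) choose (k - card T)"
    using fin finT assms(2) by (subst n_subsets) (auto simp: card_Diff_subset)
  ultimately show ?thesis by simp
qed

text \<open>The parameter \<open>b\<close> is relative to the largest possible degree. For \<open>l = 0\<close> it is a bound on the
  edge density, so that densities and degrees are treated together.\<close>

definition degrees_at_least :: "nat \<Rightarrow> nat \<Rightarrow> real \<Rightarrow> nat hgraph \<Rightarrow> bool" where
  "degrees_at_least k l b H \<longleftrightarrow> k_graph k H \<and>
     (\<forall>T\<subseteq>verts H. card T = l \<longrightarrow>
        b * real ((card (verts H) - l) choose (k - l)) \<le> real (degree k H T))"

text \<open>For \<open>F\<close> with an edge this bounds the \<open>l\<close>-degree Turan density of \<open>F\<close> by \<open>a\<close> from above.\<close>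

definition forces :: "nat \<Rightarrow> nat \<Rightarrow> real \<Rightarrow> nat hgraph \<Rightarrow> bool" where
  "forces k l a F \<longleftrightarrow> (\<forall>\<epsilon>>0. \<exists>n0. \<forall>H. degrees_at_least k l (a + \<epsilon>) H \<longrightarrow>
     n0 \<le> card (verts H) \<longrightarrow> contains_copy H F)"

lemma forcesE:
  assumes "forces k l a F" "\<epsilon> > 0"
  obtains n0 where "\<And>H. degrees_at_least k l (a + \<epsilon>) H \<Longrightarrow> n0 \<le> card (verts H) \<Longrightarrow> contains_copy H F"
  using assms unfolding forces_def by meson

text \<open>Colourings are total functions, so that they can be pulled back along a map of vertices by
  composition. For \<open>q \<ge> 1\<close>, a constant colouring shows that an uncolourable hypergraph has an edge.\<close>

definition uncolourable :: "nat \<Rightarrow> nat hgraph \<Rightarrow> bool" where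
  "uncolourable q F \<longleftrightarrow>
     (\<forall>c :: nat \<Rightarrow> nat. (\<forall>v. c v < q) \<longrightarrow> (\<exists>e\<in>edges F. \<exists>i. \<forall>v\<in>e. c v = i))"

lemma degree_empty:
  assumes "k_graph k H"
  shows "degree k H {} = card (edges H)"
proof -
  have "{T'. T' \<subseteq> verts H - {} \<and> card T' = k - card {} \<and> {} \<union> T' \<in> edges H} = edges H"
    using assms by (auto simp: k_graph_def)
  then show ?thesis by (simp add: degree_def)
qed

lemma degrees_at_least_0:
  "degrees_at_least k 0 b H \<longleftrightarrow>
     k_graph k H \<and> b * real (card (verts H) choose k) \<le> real (card (edges H))"
proof -
  have "(\<forall>T\<subseteq>verts H. card T = 0 \<longrightarrow> P T) \<longleftrightarrow> P {}" if H: "k_graph k H" for P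
  proof -
    have "T \<subseteq> verts H \<and> card T = 0 \<longleftrightarrow> T = {}" for T
    proof -
      have "finite T" if "T \<subseteq> verts H"
        using H finite_subset[OF that] by (simp add: k_graph_def)
      then show ?thesis by (cases "T \<subseteq> verts H") auto
    qed
    then show ?thesis by metis
  qed
  then show ?thesis
    unfolding degrees_at_least_def using degree_empty[of k H] by (cases "k_graph k H") simp_all
qed

lemma contains_copy_mono:
  assumes "contains_copy H F" "verts H \<subseteq> verts H'" "edges H \<subseteq> edges H'"
  shows "contains_copy H' F"
proof -
  from assms(1) obtain f where "inj_on f (verts F)" "f ` verts F \<subseteq> verts H" "\<forall>e\<in>edges F. f ` e \<in> edges H"
    unfolding contains_copy_def by (elim exE conjE)
  then show ?thesis
    unfolding contains_copy_def using assms(2,3) by (intro exI[of _ f]) auto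
qed

text \<open>Deleting vertices of low degree one by one increases the surplus of edges over the required
  density, so the process must stop, at a subgraph of large minimum degree. It stops while the
  subgraph is still large, because the surplus of \<open>\<epsilon>/2\<close> times all \<open>k\<close>-sets has to
  fit into it. In place of the process, the proof takes a smallest set \<open>W\<close> that retains the surplus.\<close>

lemma forces_density_of_forces_degree:
  assumes F: "forces k 1 a F" and k: "k \<ge> 1" and a: "a \<ge> 0"
  shows "forces k 0 a F"
  unfolding forces_def
proof (intro allI impI)
  fix \<epsilon> :: real assume \<epsilon>: "\<epsilon> > 0"
  define b where "b = a + \<epsilon> / 2"
  have b0: "b \<ge> 0" using a \<epsilon> by (simp add: b_def)
  have "\<epsilon> / 2 > 0" using \<epsilon> by simp
  from forcesE[OF F this] obtain n0 where
    n0: "\<And>H. degrees_at_least k 1 b H \<Longrightarrow> n0 \<le> card (verts H) \<Longrightarrow> contains_copy H F"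
    unfolding b_def by blast
  have "\<forall>\<^sub>F n in sequentially. real (n choose k) > real (n0 choose k) / (\<epsilon> / 2)"
    using choose_at_top[OF k] by (simp add: filterlim_at_top_dense)
  then obtain N where N: "\<And>n. n \<ge> N \<Longrightarrow> real (n choose k) > real (n0 choose k) / (\<epsilon> / 2)"
    by (auto simp: eventually_sequentially)
  show "\<exists>N. \<forall>H. degrees_at_least k 0 (a + \<epsilon>) H \<longrightarrow> N \<le> card (verts H) \<longrightarrow> contains_copy H F"
  proof (intro exI[of _ N] allI impI)
    fix H
    assume "degrees_at_least k 0 (a + \<epsilon>) H" and "N \<le> card (verts H)"
    moreover define n where "n = card (verts H)"
    ultimately have H: "k_graph k H" and dens: "(a + \<epsilon>) * real (n choose k) \<le> real (card (edges H))"
      and n: "real (n choose k) > real (n0 choose k) / (\<epsilon> / 2)"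
      using N by (auto simp: degrees_at_least_0)
    have fin: "finite (verts H)" using H by (simp add: k_graph_def)
    define E where "E W = {e\<in>edges H. e \<subseteq> W}" for W
    define good where "good W \<longleftrightarrow> W \<subseteq> verts H \<and>
       \<epsilon>/2 * real (n choose k) + b * real (card W choose k) \<le> real (card (E W))" for W
    have "E (verts H) = edges H" using H by (auto simp: E_def k_graph_def)
    then have "good (verts H)"
      using dens by (simp add: good_def b_def n_def[symmetric] algebra_simps)
    then obtain W where W: "good W" and Wmin: "\<And>W'. good W' \<Longrightarrow> card W \<le> card W'"
      using ex_has_least_nat[of good "verts H" card] by blast
    have WH: "W \<subseteq> verts H" using W by (simp add: good_def)
    have finW: "finite W" using WH fin finite_subset by blast
    have "E W \<subseteq> {e. e \<subseteq> W \<and> card e = k}" using H by (auto simp: E_def k_graph_def)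
    from card_mono[OF _ this] have "card (E W) \<le> card W choose k"
      using finW by (simp add: n_subsets)
    then have "real (card (E W)) \<le> real (card W choose k)" by simp
    moreover have "0 \<le> b * real (card W choose k)" using b0 by simp
    ultimately have "\<epsilon>/2 * real (n choose k) \<le> real (card W choose k)"
      using W unfolding good_def by linarith
    moreover have "\<epsilon>/2 * real (n choose k) > real (n0 choose k)"
      using n \<epsilon> by (simp add: field_simps)
    ultimately have "real (n0 choose k) < real (card W choose k)" by linarith
    then have big: "card W \<ge> n0"
      using binomial_right_mono[of "card W" n0 k] by linarith
    have kW: "k_graph k (W, E W)"
      using finW H by (auto simp: k_graph_def E_def)
    have "contains_copy (W, E W) F"
    proof (rule n0)
      show "n0 \<le> card (verts (W, E W))" using big by simp
      have "b * real ((card W - 1) choose (k - 1)) \<le> real (degree k (W, E W) T)"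
        if T: "T \<subseteq> W" "card T = 1" for T
      proof (rule ccontr)
        assume low: "\<not> b * real ((card W - 1) choose (k - 1)) \<le> real (degree k (W, E W) T)"
        from T obtain v where v: "T = {v}" "v \<in> W" by (auto simp: card_1_singleton_iff)
        have cW: "card W = Suc (card (W - {v}))" using v finW by (intro card.remove)
        \<comment> \<open>If \<open>v\<close> had low degree, then \<open>W - {v}\<close> would be a smaller set with the same surplus, by Pascal's rule.\<close>
        have split: "E W = E (W - {v}) \<union> {e \<in> E W. v \<in> e}" by (auto simp: E_def)
        have "{e \<in> E W. v \<in> e} \<subseteq> insert v ` {T'. T' \<subseteq> W - {v} \<and> card T' = k - 1 \<and> insert v T' \<in> E W}"
        proof
          fix e assume e: "e \<in> {e \<in> E W. v \<in> e}"
          then have "card e = k" "finite e"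
            using H finW by (auto simp: E_def k_graph_def intro: finite_subset)
          then have "e = insert v (e - {v}) \<and> e - {v} \<subseteq> W - {v} \<and> card (e - {v}) = k - 1"
            using e by (auto simp: E_def)
          then show "e \<in> insert v ` {T'. T' \<subseteq> W - {v} \<and> card T' = k - 1 \<and> insert v T' \<in> E W}"
            using e by (intro image_eqI[of _ _ "e - {v}"]) auto
        qed
        then have "card {e \<in> E W. v \<in> e} \<le> card {T'. T' \<subseteq> W - {v} \<and> card T' = k - 1 \<and> insert v T' \<in> E W}"
          by (rule surj_card_le[rotated]) (use finW in auto)
        also have "\<dots> = degree k (W, E W) T" by (simp add: degree_def v)
        finally have dv: "card {e \<in> E W. v \<in> e} \<le> degree k (W, E W) T" .
        have "card (E W) \<le> card (E (W - {v})) + card {e \<in> E W. v \<in> e}"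
          by (subst split) (rule card_Un_le)
        with dv have "real (card (E W)) \<le> real (card (E (W - {v}))) + real (degree k (W, E W) T)"
          by linarith
        moreover have "card W choose k = (card (W - {v}) choose k) + (card (W - {v}) choose (k - 1))"
          using k cW by (cases k) auto
        ultimately have "good (W - {v})"
          using W low WH cW by (auto simp: good_def algebra_simps)
        from Wmin[OF this] cW show False by simp
      qed
      with kW show "degrees_at_least k 1 b (W, E W)" by (simp add: degrees_at_least_def)
    qed
    then show "contains_copy H F"
      by (rule contains_copy_mono) (use WH in \<open>auto simp: E_def\<close>)
  qed
qed

section \<open>Attaching copies inside common links\<close>

definition extends :: "nat hgraph \<Rightarrow> nat hgraph \<Rightarrow> bool" where
  "extends G' G \<longleftrightarrow> verts G \<subseteq> verts G' \<and> edges G \<subseteq> edges G'"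

text \<open>The copy of \<open>F\<close> on new vertices lies in the link of every \<open>T\<close>. Colourings of \<open>G'\<close> will be pulled
  back to \<open>F\<close> along \<open>\<phi>\<close>.\<close>

definition joined_copy :: "nat hgraph \<Rightarrow> nat set set \<Rightarrow> nat hgraph \<Rightarrow> nat hgraph \<Rightarrow> bool" where
  "joined_copy F TT G G' \<longleftrightarrow> (\<exists>\<phi>. \<phi> ` verts F \<subseteq> verts G' - verts G \<and>
     (\<forall>T\<in>TT. \<forall>e\<in>edges F. T \<union> \<phi> ` e \<in> edges G'))"

lemma extends_trans: "extends G2 G1 \<Longrightarrow> extends G1 G \<Longrightarrow> extends G2 G"
  by (auto simp: extends_def)

lemma joined_copy_mono:
  assumes "joined_copy F TT G1 G1'" "extends G1 G" "extends G2 G1'"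
  shows "joined_copy F TT G G2"
proof -
  from assms(1) obtain \<phi> where \<phi>: "\<phi> ` verts F \<subseteq> verts G1' - verts G1"
     "\<forall>T\<in>TT. \<forall>e\<in>edges F. T \<union> \<phi> ` e \<in> edges G1'"
    unfolding joined_copy_def by (elim exE conjE)
  have "\<phi> ` verts F \<subseteq> verts G2 - verts G"
    using order.trans[OF \<phi>(1) Diff_mono] assms(2,3) unfolding extends_def by auto
  moreover have "\<forall>T\<in>TT. \<forall>e\<in>edges F. T \<union> \<phi> ` e \<in> edges G2"
    using \<phi>(2) assms(3) unfolding extends_def by auto
  ultimately show ?thesis unfolding joined_copy_def by (intro exI[of _ \<phi>] conjI)
qed

text \<open>Embed \<open>G\<close> in the host. Every \<open>l\<close>-set lacks at most a fraction \<open>d - \<epsilon>\<close> of the \<open>r\<close>-sets, so the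
  images of the at most \<open>q\<close> sets in \<open>TT\<close> have a common link of density at least \<open>1 - q * (d - \<epsilon>)\<close>.
  Restricting the link to the vertices outside the image of \<open>G\<close> changes this density by \<open>o(1)\<close> only,
  and it remains large enough to contain \<open>F\<close>.\<close>

lemma forces_glue:
  fixes d :: real
  assumes G: "k_graph (l + r) G" "forces (l + r) l (1 - d) G"
    and F: "k_graph r F" "forces r 0 (1 - real q * d) F"
    and q: "q \<ge> 1"
    and TT: "finite TT" "card TT \<le> q" "\<And>T. T \<in> TT \<Longrightarrow> T \<subseteq> verts G \<and> card T = l"
  shows "\<exists>G'. k_graph (l + r) G' \<and> forces (l + r) l (1 - d) G' \<and>
     extends G' G \<and> joined_copy F TT G G'"
proof -
  have finG: "finite (verts G)" and finF: "finite (verts F)"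
    using G F by (auto simp: k_graph_def)
  \<comment> \<open>The new copy of \<open>F\<close> is its translate by \<open>s\<close>, beyond all vertices of \<open>G\<close>; \<open>Max\<close> needs a nonempty set.\<close>
  define s where "s = Suc (Max (insert 0 (verts G)))"
  have s: "v < s" if "v \<in> verts G" for v
    using that finG by (simp add: s_def less_Suc_eq_le)
  define \<phi> where "\<phi> v = s + v" for v :: nat
  have inj: "inj \<phi>" by (auto simp: \<phi>_def inj_on_def)
  have new: "\<phi> v \<notin> verts G" for v using s by (force simp: \<phi>_def)
  define G' where "G' = (verts G \<union> \<phi> ` verts F,
      edges G \<union> {T \<union> \<phi> ` e | T e. T \<in> TT \<and> e \<in> edges F})"
  have kG': "k_graph (l + r) G'"
  proof -
    have "T \<union> \<phi> ` e \<subseteq> verts G \<union> \<phi> ` verts F \<and> card (T \<union> \<phi> ` e) = l + r"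
      if "T \<in> TT" "e \<in> edges F" for T e
    proof -
      have T: "T \<subseteq> verts G" "card T = l" "finite T"
        using TT(3)[OF that(1)] finG finite_subset by auto
      have e: "e \<subseteq> verts F" "card e = r" "finite e"
        using F(1) that(2) finF by (auto simp: k_graph_def intro: finite_subset)
      have "card (\<phi> ` e) = r" using e inj by (simp add: card_image inj_on_subset)
      moreover have "T \<inter> \<phi> ` e = {}" using T(1) new by auto
      ultimately show ?thesis using T e by (auto simp: card_Un_disjoint)
    qed
    moreover have "finite (verts G \<union> \<phi> ` verts F)" using finG finF by simp
    moreover have "edges G \<subseteq> {e. e \<subseteq> verts G \<union> \<phi> ` verts F \<and> card e = l + r}"
      using G(1) unfolding k_graph_def by blast
    ultimately show ?thesis unfolding k_graph_def G'_def fst_conv snd_conv by blast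
  qed
  have "forces (l + r) l (1 - d) G'"
    unfolding forces_def
  proof (intro allI impI)
    fix \<epsilon> :: real assume \<epsilon>: "\<epsilon> > 0"
    define u where "u = card (verts G)"
    from forcesE[OF G(2) \<epsilon>] obtain n1 where
      n1: "\<And>H. degrees_at_least (l + r) l (1 - d + \<epsilon>) H \<Longrightarrow> n1 \<le> card (verts H) \<Longrightarrow> contains_copy H G"
      by blast
    have "\<epsilon> / 2 > 0" using \<epsilon> by simp
    from forcesE[OF F(2) this] obtain n2 where
      n2: "\<And>H. degrees_at_least r 0 (1 - real q * d + \<epsilon> / 2) H \<Longrightarrow> n2 \<le> card (verts H) \<Longrightarrow> contains_copy H F"
      by blast
    \<comment> \<open>The gain \<open>q * \<epsilon>\<close> in density exceeds the \<open>\<epsilon>/2\<close> demanded for \<open>F\<close>; the rest absorbs the loss of the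
      \<open>u\<close> vertices used by \<open>G\<close>.\<close>
    have "(\<lambda>n. real q * (d - \<epsilon>) * (real ((n - l) choose r) / real ((n - u) choose r)))
        \<longlonglongrightarrow> real q * (d - \<epsilon>) * 1 ^ r"
      by (intro tendsto_intros choose_ratio_tendsto shift_ratio_tendsto)
    moreover have "real q * (d - \<epsilon>) * 1 ^ r < real q * d - \<epsilon> / 2"
    proof -
      have "\<epsilon> * 1 \<le> \<epsilon> * real q" using q \<epsilon> by (intro mult_left_mono) auto
      then show ?thesis using \<epsilon> by (simp add: algebra_simps)
    qed
    ultimately have "\<forall>\<^sub>F n in sequentially.
       real q * (d - \<epsilon>) * (real ((n - l) choose r) / real ((n - u) choose r)) < real q * d - \<epsilon> / 2"
      by (rule order_tendstoD)
    then obtain n3 where n3: "\<And>n. n \<ge> n3 \<Longrightarrow>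
       real q * (d - \<epsilon>) * (real ((n - l) choose r) / real ((n - u) choose r)) < real q * d - \<epsilon> / 2"
      by (auto simp: eventually_sequentially)
    show "\<exists>n0. \<forall>H. degrees_at_least (l + r) l (1 - d + \<epsilon>) H \<longrightarrow> n0 \<le> card (verts H) \<longrightarrow> contains_copy H G'"
    proof (intro exI[of _ "n1 + n2 + n3 + u + r + l"] allI impI)
      fix H
      assume dense: "degrees_at_least (l + r) l (1 - d + \<epsilon>) H"
        and large: "n1 + n2 + n3 + u + r + l \<le> card (verts H)"
      define n where "n = card (verts H)"
      have n: "n \<ge> n1" "n \<ge> n2 + u" "n \<ge> n3" "n \<ge> u + r" "n \<ge> l" using large by (auto simp: n_def)
      have H: "k_graph (l + r) H" "card (verts H) = n"
        and deg: "\<And>T. T \<subseteq> verts H \<Longrightarrow> card T = l \<Longrightarrow>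
          (1 - d + \<epsilon>) * real ((n - l) choose r) \<le> real (degree (l + r) H T)"
        using dense by (auto simp: degrees_at_least_def n_def)
      have finH: "finite (verts H)" using H by (simp add: k_graph_def)
      from n1[OF dense] n(1) H(2) obtain f where f: "inj_on f (verts G)" "f ` verts G \<subseteq> verts H"
         "\<forall>e\<in>edges G. f ` e \<in> edges H" by (auto simp: contains_copy_def)
      define W where "W = verts H - f ` verts G"
      have cW: "card W = n - u"
        using f finG H by (simp add: W_def card_Diff_subset card_image u_def)
      have finW: "finite W" using finH by (simp add: W_def)
      define L where "L = {S. S \<subseteq> W \<and> card S = r \<and> (\<forall>T\<in>TT. f ` T \<union> S \<in> edges H)}"
      define x where "x = (d - \<epsilon>) * real ((n - l) choose r)"
      have missing: "real (card {S. S \<subseteq> verts H - T \<and> card S = r \<and> T \<union> S \<notin> edges H}) \<le> x"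
        if "T \<subseteq> verts H" "card T = l" for T
        using degree_plus_missing[OF H(1) that(1)] deg[OF that] that H(2)
        by (simp add: x_def algebra_simps)
      \<comment> \<open>The sign of \<open>x\<close> matters because \<open>TT\<close> may have fewer than \<open>q\<close> members. As \<open>d < \<epsilon>\<close> is not excluded,
        it is read off from an actual \<open>l\<close>-set of the host.\<close>
      have x0: "x \<ge> 0"
      proof -
        from n(5) H(2) obtain T where "T \<subseteq> verts H" "card T = l"
          by (metis obtain_subset_with_card_n)
        from missing[OF this] show ?thesis by (meson of_nat_0_le_iff order_trans)
      qed
      have miss_T: "real (card {S. S \<subseteq> W \<and> card S = r \<and> f ` T \<union> S \<notin> edges H}) \<le> x"
        if "T \<in> TT" for T
      proof -
        have T: "T \<subseteq> verts G" "card T = l" using TT(3)[OF that] by auto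
        have fT: "f ` T \<subseteq> verts H" "card (f ` T) = l"
          using T f by (auto simp: card_image inj_on_subset)
        have "card {S. S \<subseteq> W \<and> card S = r \<and> f ` T \<union> S \<notin> edges H}
            \<le> card {S. S \<subseteq> verts H - f ` T \<and> card S = r \<and> f ` T \<union> S \<notin> edges H}"
          by (rule card_mono, rule finite_subset[of _ "Pow (verts H)"])
            (use finH T(1) in \<open>auto simp: W_def\<close>)
        with missing[OF fT] show ?thesis by linarith
      qed
      have sub: "{S. S \<subseteq> W \<and> card S = r} \<subseteq>
         L \<union> (\<Union>T\<in>TT. {S. S \<subseteq> W \<and> card S = r \<and> f ` T \<union> S \<notin> edges H})"
        by (auto simp: L_def)
      have finS: "finite {S. S \<subseteq> W \<and> P S}" for P
        by (rule finite_subset[of _ "Pow W"]) (use finW in auto)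
      have finL: "finite L" unfolding L_def by (rule finS)
      have "(n - u) choose r = card {S. S \<subseteq> W \<and> card S = r}"
        using finW cW by (simp add: n_subsets)
      also have "\<dots> \<le> card (L \<union> (\<Union>T\<in>TT. {S. S \<subseteq> W \<and> card S = r \<and> f ` T \<union> S \<notin> edges H}))"
        by (rule card_mono[OF _ sub]) (use finL finS TT(1) in auto)
      also have "\<dots> \<le> card L + card (\<Union>T\<in>TT. {S. S \<subseteq> W \<and> card S = r \<and> f ` T \<union> S \<notin> edges H})"
        by (rule card_Un_le)
      also have "\<dots> \<le> card L + (\<Sum>T\<in>TT. card {S. S \<subseteq> W \<and> card S = r \<and> f ` T \<union> S \<notin> edges H})"
        by (intro add_left_mono card_UN_le TT(1))
      finally have "real ((n - u) choose r) \<le> real (card L)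
          + (\<Sum>T\<in>TT. real (card {S. S \<subseteq> W \<and> card S = r \<and> f ` T \<union> S \<notin> edges H}))"
        by (simp flip: of_nat_sum of_nat_add)
      also have "\<dots> \<le> real (card L) + real (card TT) * x"
        by (intro add_left_mono sum_bounded_above miss_T)
      also have "\<dots> \<le> real (card L) + real q * x"
        using TT(2) x0 by (intro add_left_mono mult_right_mono) auto
      finally have Lbig: "real ((n - u) choose r) - real q * x \<le> real (card L)" by simp
      have pos: "real ((n - u) choose r) > 0" using n(4) by simp
      have "real q * x \<le> (real q * d - \<epsilon> / 2) * real ((n - u) choose r)"
        using n3[OF n(3)] pos by (simp add: x_def field_simps)
      with Lbig have "(1 - real q * d + \<epsilon> / 2) * real ((n - u) choose r) \<le> real (card L)"
        by (simp add: algebra_simps)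
      moreover have kL: "k_graph r (W, L)" using finW by (auto simp: k_graph_def L_def)
      ultimately have "degrees_at_least r 0 (1 - real q * d + \<epsilon> / 2) (W, L)"
        using cW by (simp add: degrees_at_least_0)
      then have "contains_copy (W, L) F" by (rule n2) (use cW n(2) in simp)
      then obtain g where g: "inj_on g (verts F)" "g ` verts F \<subseteq> W" "\<forall>e\<in>edges F. g ` e \<in> L"
        by (auto simp: contains_copy_def)
      define h where "h v = (if v < s then f v else g (v - s))" for v
      have hG: "h v = f v" if "v \<in> verts G" for v using s[OF that] by (simp add: h_def)
      have hF: "h (\<phi> v) = g v" for v by (simp add: h_def \<phi>_def)
      have hGi: "h ` A = f ` A" if "A \<subseteq> verts G" for A using that hG by force
      have hFi: "h ` \<phi> ` A = g ` A" for A by (simp add: image_image hF)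
      have "inj_on h (verts G \<union> \<phi> ` verts F)"
      proof -
        have "inj_on h (verts G)" using f(1) hG by (simp cong: inj_on_cong)
        moreover have "inj_on h (\<phi> ` verts F)"
          using g(1) by (auto simp: inj_on_def hF)
        moreover have "h ` verts G \<inter> h ` \<phi> ` verts F = {}"
          using g(2) by (auto simp: hGi hFi W_def)
        ultimately show ?thesis by (auto simp: inj_on_Un)
      qed
      moreover have "h ` (verts G \<union> \<phi> ` verts F) \<subseteq> verts H"
        using f(2) g(2) by (auto simp: image_Un hGi hFi W_def)
      moreover have "h ` e \<in> edges H" if "e \<in> edges G" for e
        using f(3) that hGi[of e] G(1) by (auto simp: k_graph_def)
      moreover have "h ` (T \<union> \<phi> ` e) \<in> edges H" if "T \<in> TT" "e \<in> edges F" for T e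
        using g(3) that TT(3)[OF that(1)] by (auto simp: image_Un hGi hFi L_def)
      ultimately show "contains_copy H G'"
        unfolding contains_copy_def G'_def by (intro exI[of _ h]) auto
    qed
  qed
  moreover have "extends G' G" by (auto simp: extends_def G'_def)
  moreover have "joined_copy F TT G G'"
    unfolding joined_copy_def using new by (intro exI[of _ \<phi>]) (auto simp: G'_def)
  ultimately show ?thesis using kG' by blast
qed

lemma forces_glue_all:
  fixes d :: real
  assumes G: "k_graph (l + r) G" "forces (l + r) l (1 - d) G"
    and F: "k_graph r F" "forces r 0 (1 - real q * d) F"
    and q: "q \<ge> 1"
  shows "\<exists>G'. k_graph (l + r) G' \<and> forces (l + r) l (1 - d) G' \<and> extends G' G \<and>
     (\<forall>TT. TT \<subseteq> {T. T \<subseteq> verts G \<and> card T = l} \<and> card TT \<le> q \<longrightarrow> joined_copy F TT G G')"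
proof -
  have finG: "finite (verts G)" using G by (simp add: k_graph_def)
  have fin: "finite {T. T \<subseteq> verts G \<and> card T = l}" using finG by simp
  have "\<exists>G'. k_graph (l + r) G' \<and> forces (l + r) l (1 - d) G' \<and> extends G' G \<and>
     (\<forall>TT\<in>\<A>. joined_copy F TT G G')"
    if "finite \<A>" "\<forall>TT\<in>\<A>. TT \<subseteq> {T. T \<subseteq> verts G \<and> card T = l} \<and> card TT \<le> q" for \<A>
    using that
  proof (induction \<A> rule: finite_induct)
    case empty
    then show ?case using G by (intro exI[of _ G]) (auto simp: extends_def)
  next
    case (insert TT \<A>)
    then have "\<exists>G'. k_graph (l + r) G' \<and> forces (l + r) l (1 - d) G' \<and> extends G' G \<and>
     (\<forall>TT\<in>\<A>. joined_copy F TT G G')" by simp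
    then obtain G1 where G1: "k_graph (l + r) G1" "forces (l + r) l (1 - d) G1" "extends G1 G"
        "\<forall>TT\<in>\<A>. joined_copy F TT G G1"
      by (elim exE conjE)
    have TT: "TT \<subseteq> {T. T \<subseteq> verts G \<and> card T = l}" "card TT \<le> q" using insert.prems by auto
    have finTT: "finite TT" using TT(1) fin by (rule finite_subset)
    have "T \<subseteq> verts G1 \<and> card T = l" if "T \<in> TT" for T
    proof -
      have "T \<subseteq> verts G" "card T = l" using that TT(1) by auto
      then show ?thesis using G1(3) by (auto simp: extends_def)
    qed
    from forces_glue[OF G1(1,2) F q finTT TT(2) this]
    obtain G2 where G2: "k_graph (l + r) G2" "forces (l + r) l (1 - d) G2" "extends G2 G1"
        "joined_copy F TT G1 G2"
      by blast
    have refl: "extends X X" for X by (simp add: extends_def)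
    have "joined_copy F SS G G2" if SS: "SS \<in> insert TT \<A>" for SS
    proof (cases "SS = TT")
      case True
      then show ?thesis using joined_copy_mono[OF G2(4) G1(3) refl] by simp
    next
      case False
      then show ?thesis using SS G1(4) joined_copy_mono[OF _ refl G2(3)] by blast
    qed
    then show ?case using G2(1,2) extends_trans[OF G2(3) G1(3)] by blast
  qed
  note main = this
  define \<A> where "\<A> = {TT. TT \<subseteq> {T. T \<subseteq> verts G \<and> card T = l} \<and> card TT \<le> q}"
  have "finite \<A>"
    by (rule finite_subset[of _ "Pow {T. T \<subseteq> verts G \<and> card T = l}"]) (use fin in \<open>auto simp: \<A>_def\<close>)
  from main[OF this] show ?thesis
    unfolding \<A>_def by (simp only: mem_Collect_eq Ball_def simp_thms)
qed

section \<open>Uncolourable hypergraphs that are forced\<close>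

text \<open>This is the progress measure for attaching copies: the number of coloured vertices, where each
  colour counts at most \<open>l\<close> times. It is bounded by \<open>q * l\<close>.\<close>

definition colour_score :: "nat \<Rightarrow> nat \<Rightarrow> nat set \<Rightarrow> (nat \<Rightarrow> nat) \<Rightarrow> nat" where
  "colour_score q l V c = (\<Sum>i<q. min l (card {v\<in>V. c v = i}))"

lemma colour_score_less:
  assumes "finite V'" "V \<subseteq> V'" "v \<in> V' - V" "c v < q" "card {w\<in>V. c w = c v} < l"
  shows "colour_score q l V c < colour_score q l V' c"
  unfolding colour_score_def
proof (rule sum_strict_mono_ex1)
  show "\<forall>i\<in>{..<q}. min l (card {v\<in>V. c v = i}) \<le> min l (card {v\<in>V'. c v = i})"
  proof
    fix i
    have "card {v\<in>V. c v = i} \<le> card {v\<in>V'. c v = i}"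
      using assms(1,2) by (intro card_mono) auto
    then show "min l (card {v\<in>V. c v = i}) \<le> min l (card {v\<in>V'. c v = i})" by linarith
  qed
  have "card {w\<in>V. c w = c v} < card {w\<in>V'. c w = c v}"
    using assms(1-3) by (intro psubset_card_mono) auto
  then show "\<exists>i\<in>{..<q}. min l (card {v\<in>V. c v = i}) < min l (card {v\<in>V'. c v = i})"
    using assms(4,5) by (intro bexI[of _ "c v"]) auto
qed simp

text \<open>Every round of attaching copies raises the score of each colouring without monochromatic edge,
  because the copy attached to the full colour classes has a monochromatic edge in a colour that is not yet
  full. One copy per family suffices, since a single new vertex in that colour already raises the score.
  Once the score would have to exceed its bound, no such colouring is left.\<close>

lemma exists_uncolourable_degree_forced:
  fixes d :: real
  assumes F: "k_graph r F" "forces r 0 (1 - real q * d) F" "uncolourable q F"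
    and q: "q \<ge> 1" and r: "r \<ge> 1"
  shows "\<exists>G. k_graph (l + r) G \<and> forces (l + r) l (1 - d) G \<and> uncolourable q G"
proof -
  have "\<exists>G. k_graph (l + r) G \<and> forces (l + r) l (1 - d) G \<and>
     (\<forall>c. (\<forall>v. c v < q) \<and> (\<forall>e\<in>edges G. \<not> (\<exists>i. \<forall>v\<in>e. c v = i)) \<longrightarrow> m \<le> colour_score q l (verts G) c)"
    for m
  proof (induction m)
    case 0
    show ?case
      by (intro exI[of _ "({}, {})"])
        (auto simp: k_graph_def forces_def contains_copy_def)
  next
    case (Suc m)
    then obtain G where G: "k_graph (l + r) G" "forces (l + r) l (1 - d) G"
      and score: "\<And>c. (\<forall>v. c v < q) \<Longrightarrow> (\<forall>e\<in>edges G. \<not> (\<exists>i. \<forall>v\<in>e. c v = i)) \<Longrightarrow>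
         m \<le> colour_score q l (verts G) c" by blast
    from forces_glue_all[OF G F(1,2) q]
    obtain G' where G': "k_graph (l + r) G'" "forces (l + r) l (1 - d) G'" "extends G' G"
      and copies: "\<And>TT. TT \<subseteq> {T. T \<subseteq> verts G \<and> card T = l} \<Longrightarrow> card TT \<le> q \<Longrightarrow> joined_copy F TT G G'"
      by blast
    have "Suc m \<le> colour_score q l (verts G') c"
      if c: "\<forall>v. c v < q" and proper: "\<forall>e\<in>edges G'. \<not> (\<exists>i. \<forall>v\<in>e. c v = i)" for c
    proof -
      \<comment> \<open>The full colours. In the first rounds there may be none; then the copy is attached to the
        empty family, where it only contributes vertices.\<close>
      define C where "C = {i. i < q \<and> l \<le> card {v\<in>verts G. c v = i}}"
      have "\<exists>T. T \<subseteq> {v\<in>verts G. c v = i} \<and> card T = l" if "i \<in> C" for i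
        using that by (metis (no_types, lifting) C_def mem_Collect_eq obtain_subset_with_card_n)
      then obtain T where T: "\<And>i. i \<in> C \<Longrightarrow> T i \<subseteq> {v\<in>verts G. c v = i} \<and> card (T i) = l"
        by metis
      have "card (T ` C) \<le> card C" by (rule card_image_le) (simp add: C_def)
      also have "\<dots> \<le> card {..<q}" by (rule card_mono) (auto simp: C_def)
      finally have "card (T ` C) \<le> q" by simp
      moreover have "T ` C \<subseteq> {T. T \<subseteq> verts G \<and> card T = l}" using T by blast
      ultimately obtain \<phi> where \<phi>: "\<phi> ` verts F \<subseteq> verts G' - verts G"
         "\<forall>T\<in>T ` C. \<forall>e\<in>edges F. T \<union> \<phi> ` e \<in> edges G'"
        using copies[of "T ` C"] unfolding joined_copy_def by blast
      from F(3)[unfolded uncolourable_def, rule_format, of "c \<circ> \<phi>"] c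
      obtain e i where e: "e \<in> edges F" "\<forall>v\<in>e. c (\<phi> v) = i" by auto
      have "card e = r" "e \<subseteq> verts F" using F(1) e(1) by (auto simp: k_graph_def)
      with r have "e \<noteq> {}" by auto
      then obtain v where v: "v \<in> e" by auto
      have iq: "i < q" using c e(2) v by auto
      have "i \<notin> C"
      proof
        assume i: "i \<in> C"
        then have "T i \<union> \<phi> ` e \<in> edges G'" using \<phi>(2) e(1) by blast
        moreover have "\<forall>v\<in>T i \<union> \<phi> ` e. c v = i" using T[OF i] e(2) by blast
        ultimately show False using proper by blast
      qed
      then have "card {w\<in>verts G. c w = c (\<phi> v)} < l" using iq e(2) v by (auto simp: C_def)
      moreover have "\<phi> v \<in> verts G' - verts G" using \<phi>(1) v \<open>e \<subseteq> verts F\<close> by blast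
      moreover have "finite (verts G')" using G'(1) by (simp add: k_graph_def)
      ultimately have "colour_score q l (verts G) c < colour_score q l (verts G') c"
        using G'(3) c unfolding extends_def by (intro colour_score_less[where v = "\<phi> v"]) auto
      moreover have "m \<le> colour_score q l (verts G) c"
        using proper G'(3) unfolding extends_def by (intro score[OF c]) blast
      ultimately show ?thesis by linarith
    qed
    then show ?case using G'(1,2) by blast
  qed
  from this[of "Suc (q * l)"] obtain G where G: "k_graph (l + r) G" "forces (l + r) l (1 - d) G"
    and score: "\<And>c. (\<forall>v. c v < q) \<Longrightarrow> (\<forall>e\<in>edges G. \<not> (\<exists>i. \<forall>v\<in>e. c v = i)) \<Longrightarrow>
         Suc (q * l) \<le> colour_score q l (verts G) c" by blast
  have bound: "colour_score q l V c \<le> q * l" for V c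
    unfolding colour_score_def using sum_bounded_above[of "{..<q}" "\<lambda>i. min l (card {v\<in>V. c v = i})" l]
    by simp
  have "uncolourable q G"
    unfolding uncolourable_def
  proof (intro allI impI, rule ccontr)
    fix c :: "nat \<Rightarrow> nat"
    assume "\<forall>v. c v < q" "\<not> (\<exists>e\<in>edges G. \<exists>i. \<forall>v\<in>e. c v = i)"
    then have "Suc (q * l) \<le> colour_score q l (verts G) c" by (intro score) auto
    with bound[of "verts G" c] show False by simp
  qed
  with G show ?thesis by blast
qed

text \<open>The density \<open>1 - q * q^(-r)\<close> is written so as to match the hypothesis of the previous lemma with
  \<open>d = q^(-r)\<close>. That lemma with \<open>l = 1\<close> yields the density \<open>1 - q^(-r)\<close>, which is the bound for \<open>r + 1\<close>.\<close>

lemma exists_uncolourable_density_forced: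
  assumes q: "q \<ge> 1" and r: "r \<ge> 1"
  shows "\<exists>F. k_graph r F \<and> forces r 0 (1 - real q * (1 / real q) ^ r) F \<and> uncolourable q F"
  using r
proof (induction r rule: nat_induct_at_least)
  case base
  let ?F = "({0}, {{0}}) :: nat hgraph"
  have "forces 1 0 0 ?F"
    unfolding forces_def
  proof (intro allI impI)
    fix \<epsilon> :: real assume \<epsilon>: "\<epsilon> > 0"
    show "\<exists>n0. \<forall>H. degrees_at_least 1 0 (0 + \<epsilon>) H \<longrightarrow> n0 \<le> card (verts H) \<longrightarrow> contains_copy H ?F"
    proof (intro exI[of _ 1] allI impI)
      fix H assume "degrees_at_least 1 0 (0 + \<epsilon>) H" and n: "1 \<le> card (verts H)"
      then have H: "k_graph 1 H" and dens: "\<epsilon> * real (card (verts H)) \<le> real (card (edges H))"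
        by (auto simp: degrees_at_least_0)
      have "\<epsilon> * real (card (verts H)) > 0" using n \<epsilon> by simp
      with dens have "card (edges H) \<noteq> 0" by linarith
      then obtain e where e: "e \<in> edges H" by fastforce
      then obtain v where "e = {v}" "v \<in> verts H"
        using H by (auto simp: k_graph_def card_1_singleton_iff)
      then show "contains_copy H ?F"
        unfolding contains_copy_def using e by (intro exI[of _ "\<lambda>_. v"]) auto
    qed
  qed
  then show ?case using q
    by (intro exI[of _ ?F]) (auto simp: k_graph_def uncolourable_def)
next
  case (Suc r)
  then obtain F where F: "k_graph r F" "forces r 0 (1 - real q * (1 / real q) ^ r) F" "uncolourable q F"
    by blast
  from exists_uncolourable_degree_forced[OF F q Suc.hyps(1), of 1]
  obtain G where G: "k_graph (Suc r) G" "forces (Suc r) 1 (1 - (1 / real q) ^ r) G" "uncolourable q G"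
    by auto
  have "(1 / real q) ^ r \<le> 1" using q by (intro power_le_one) auto
  then have "forces (Suc r) 0 (1 - (1 / real q) ^ r) G"
    by (intro forces_density_of_forces_degree G(2)) auto
  moreover have "real q * (1 / real q) ^ Suc r = (1 / real q) ^ r" using q by simp
  ultimately show ?case using G(1,3) by (intro exI[of _ G]) simp
qed

section \<open>Bounds on the extremal function\<close>

lemma residue_class_card:
  assumes "q \<ge> 1"
  shows "card {v :: nat. v < n \<and> v mod q = i} \<le> n div q + 1"
proof -
  have "inj_on (\<lambda>v. v div q) {v. v < n \<and> v mod q = i}"
  proof (rule inj_onI)
    fix v w assume "v \<in> {v. v < n \<and> v mod q = i}" "w \<in> {v. v < n \<and> v mod q = i}" "v div q = w div q"
    then have "v div q * q + v mod q = w div q * q + w mod q" by simp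
    then show "v = w" by simp
  qed
  moreover have "(\<lambda>v. v div q) ` {v. v < n \<and> v mod q = i} \<subseteq> {..n div q}"
    by (auto simp: div_le_mono less_imp_le)
  ultimately show ?thesis using card_inj_on_le[of _ _ "{..n div q}"] by fastforce
qed

lemma min_degree_attained:
  assumes "k_graph k H" "l \<le> card (verts H)"
  shows "\<exists>T. T \<subseteq> verts H \<and> card T = l \<and> min_degree k l H = degree k H T"
    and "T \<subseteq> verts H \<Longrightarrow> card T = l \<Longrightarrow> min_degree k l H \<le> degree k H T"
proof -
  have "finite (verts H)" using assms by (simp add: k_graph_def)
  then have fin: "finite {T. T \<subseteq> verts H \<and> card T = l}" by simp
  moreover have "{T. T \<subseteq> verts H \<and> card T = l} \<noteq> {}"
    using assms(2) by (metis (mono_tags, lifting) empty_Collect_eq obtain_subset_with_card_n)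
  ultimately have "min_degree k l H \<in> degree k H ` {T. T \<subseteq> verts H \<and> card T = l}"
    unfolding min_degree_def by (intro Min_in) auto
  then show "\<exists>T. T \<subseteq> verts H \<and> card T = l \<and> min_degree k l H = degree k H T" by auto
  show "T \<subseteq> verts H \<Longrightarrow> card T = l \<Longrightarrow> min_degree k l H \<le> degree k H T"
    unfolding min_degree_def using fin by (intro Min_le) auto
qed

text \<open>The extremal degree is defined as a maximum over this set, so finiteness is what gives it a meaning.
  The assumption \<open>l \<le> n\<close> ensures that the minimum degree of a host is the degree of an actual \<open>l\<close>-set.\<close>

lemma finite_min_degrees:
  assumes "l \<le> n"
  shows "finite {min_degree k l H | H :: nat hgraph. k_graph k H \<and> card (verts H) = n \<and> free_of F H}"
proof (rule finite_subset)
  show "{min_degree k l H | H :: nat hgraph. k_graph k H \<and> card (verts H) = n \<and> free_of F H}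
      \<subseteq> {..(n - l) choose (k - l)}"
  proof clarsimp
    fix V :: "nat set" and E
    assume H: "k_graph k (V, E)" "n = card V"
    then obtain T where "T \<subseteq> V" "card T = l" "min_degree k l (V, E) = degree k (V, E) T"
      using min_degree_attained(1)[OF H(1), of l] assms by auto
    then show "min_degree k l (V, E) \<le> (card V - l) choose (k - l)"
      using degree_plus_missing[OF H(1), of T] H(2) by simp
  qed
qed simp

text \<open>The host consists of the \<open>k\<close>-sets meeting at least two residue classes modulo \<open>q\<close>. A copy of \<open>F\<close> in
  it would colour \<open>F\<close> by residues without a monochromatic edge. An \<open>r\<close>-set missing from the link of
  a nonempty \<open>T\<close> lies in the residue class of any element of \<open>T\<close>.\<close>

lemma ex_degree_lower:
  fixes F :: "nat hgraph"
  assumes F: "uncolourable q F" and q: "q \<ge> 1" and n: "l \<le> n" and l: "1 \<le> l" and k: "l < k"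
  shows "(n - l) choose (k - l) \<le> ex_degree k l n F + ((n div q + 1) choose (k - l))"
proof -
  define H where "H = ({..<n}, {e. e \<subseteq> {..<n} \<and> card e = k \<and> \<not> (\<exists>i. \<forall>v\<in>e. v mod q = i)})"
  have H: "k_graph k H" "card (verts H) = n" by (auto simp: k_graph_def H_def)
  have "free_of F H"
    unfolding free_of_def contains_copy_def
  proof
    assume "\<exists>f. inj_on f (verts F) \<and> f ` verts F \<subseteq> verts H \<and> (\<forall>e\<in>edges F. f ` e \<in> edges H)"
    then obtain f where f: "\<forall>e\<in>edges F. f ` e \<in> edges H" by blast
    from F[unfolded uncolourable_def, rule_format, of "\<lambda>v. f v mod q"] q
    obtain e i where "e \<in> edges F" "\<forall>v\<in>e. f v mod q = i" by auto
    with f show False by (auto simp: H_def)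
  qed
  then have "min_degree k l H \<le> ex_degree k l n F"
    unfolding ex_degree_def using H by (intro Max_ge[OF finite_min_degrees[OF n]] CollectI exI[of _ H]) simp
  moreover obtain T where T: "T \<subseteq> verts H" "card T = l" "min_degree k l H = degree k H T"
    using min_degree_attained(1)[OF H(1), of l] n H(2) by auto
  moreover have "card {S. S \<subseteq> verts H - T \<and> card S = k - l \<and> T \<union> S \<notin> edges H}
      \<le> (n div q + 1) choose (k - l)"
  proof -
    have finT: "finite T" using T(1) finite_subset by (auto simp: H_def)
    obtain t where t: "t \<in> T" using T(2) l by fastforce
    define P where "P = {v. v < n \<and> v mod q = t mod q}"
    have "S \<subseteq> P" if S: "S \<subseteq> verts H - T" "card S = k - l" "T \<union> S \<notin> edges H" for S
    proof -
      have "finite S" using S(1) finite_subset by (auto simp: H_def)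
      then have "card (T \<union> S) = k" using S T(2) finT k by (subst card_Un_disjoint) auto
      then have "\<exists>i. \<forall>v\<in>T \<union> S. v mod q = i" using S T(1) by (auto simp: H_def)
      then show ?thesis using t S(1) by (fastforce simp: P_def H_def)
    qed
    then have "card {S. S \<subseteq> verts H - T \<and> card S = k - l \<and> T \<union> S \<notin> edges H}
        \<le> card {S. S \<subseteq> P \<and> card S = k - l}"
      by (intro card_mono) (auto simp: P_def)
    also have "\<dots> = card P choose (k - l)" by (simp add: n_subsets P_def)
    also have "\<dots> \<le> (n div q + 1) choose (k - l)"
      unfolding P_def by (intro binomial_right_mono residue_class_card q)
    finally show ?thesis .
  qed
  ultimately show ?thesis using degree_plus_missing[OF H(1) T(1)] H(2) by simp
qed

lemma ex_degree_upper:
  fixes F :: "nat hgraph"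
  assumes F: "forces k l a F" "uncolourable q F" and q: "q \<ge> 1" and \<epsilon>: "\<epsilon> > 0"
  shows "\<forall>\<^sub>F n in sequentially. real (ex_degree k l n F) < (a + \<epsilon>) * real ((n - l) choose (k - l))"
proof -
  from forcesE[OF F(1) \<epsilon>] obtain n0 where
    n0: "\<And>H. degrees_at_least k l (a + \<epsilon>) H \<Longrightarrow> n0 \<le> card (verts H) \<Longrightarrow> contains_copy H F"
    by blast
  show ?thesis
    using eventually_ge_at_top[of l] eventually_ge_at_top[of n0]
  proof eventually_elim
    fix n assume n: "l \<le> n" "n0 \<le> n"
    let ?M = "{min_degree k l H | H :: nat hgraph. k_graph k H \<and> card (verts H) = n \<and> free_of F H}"
    have "edges F \<noteq> {}"
      using F(2)[unfolded uncolourable_def, rule_format, of "\<lambda>_. 0"] q by auto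
    then have "k_graph k ({..<n}, {})" "card (verts ({..<n}, {})) = n" "free_of F ({..<n}, {})"
      by (auto simp: k_graph_def free_of_def contains_copy_def)
    then have "?M \<noteq> {}" by blast
    then have "ex_degree k l n F \<in> ?M"
      unfolding ex_degree_def by (intro Max_in finite_min_degrees[OF n(1)])
    then obtain H :: "nat hgraph" where H: "k_graph k H" "card (verts H) = n" "free_of F H"
        "ex_degree k l n F = min_degree k l H" by blast
    have "\<not> degrees_at_least k l (a + \<epsilon>) H"
      using n0[of H] n(2) H(2,3) unfolding free_of_def by blast
    then obtain T where T: "T \<subseteq> verts H" "card T = l"
        "real (degree k H T) < (a + \<epsilon>) * real ((n - l) choose (k - l))"
      using H(1,2) by (auto simp: degrees_at_least_def not_le)
    have "min_degree k l H \<le> degree k H T"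
      by (rule min_degree_attained(2)[OF H(1)]) (use H T n in auto)
    then show "real (ex_degree k l n F) < (a + \<epsilon>) * real ((n - l) choose (k - l))"
      using T(3) H(4) by linarith
  qed
qed

lemma block_ratio_tendsto:
  assumes "q \<ge> 1"
  shows "(\<lambda>n. real (n div q + 1) / real n) \<longlonglongrightarrow> 1 / real q"
proof (rule tendsto_sandwich[where f = "\<lambda>_. 1 / real q" and h = "\<lambda>n. 1 / real q + 1 / real n"])
  show "(\<lambda>n. 1 / real q + 1 / real n) \<longlonglongrightarrow> 1 / real q"
    using tendsto_add[OF tendsto_const lim_1_over_n, of "1 / real q"] by simp
  show "\<forall>\<^sub>F n in sequentially. 1 / real q \<le> real (n div q + 1) / real n"
    using eventually_gt_at_top[of 0]
  proof eventually_elim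
    fix n :: nat assume n: "n > 0"
    have "n \<le> q * (n div q + 1)"
      using dividend_less_times_div[of q n] assms by simp
    then have "real n \<le> real (q * (n div q + 1))" by (simp only: of_nat_le_iff)
    then have "real n \<le> real q * real (n div q + 1)" by (simp only: of_nat_mult)
    then show "1 / real q \<le> real (n div q + 1) / real n"
      using n assms by (simp add: field_simps)
  qed
  show "\<forall>\<^sub>F n in sequentially. real (n div q + 1) / real n \<le> 1 / real q + 1 / real n"
    using eventually_gt_at_top[of 0]
  proof eventually_elim
    fix n :: nat assume n: "n > 0"
    have "real (n div q) \<le> real n / real q" by (rule of_nat_div_le_of_nat)
    then have "real (n div q) / real n \<le> (real n / real q) / real n"
      by (rule divide_right_mono) simp
    then show "real (n div q + 1) / real n \<le> 1 / real q + 1 / real n"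
      using n by (simp add: add_divide_distrib)
  qed
qed simp

section \<open>The degree Turan densities\<close>

theorem theorem1p2:
  fixes k l q :: nat
  assumes "k > l" and "l \<ge> 1" and "q \<ge> 1"
  shows "\<exists>F :: nat hgraph. k_graph k F \<and> edges F \<noteq> {} \<and>
           convergent (degree_ratio k l F) \<and>
           turan_density k l F = 1 - real q powi (int l - int k)"
proof -
  define r where "r = k - l"
  have r: "r \<ge> 1" and k: "k = l + r" using assms by (auto simp: r_def)
  define a where "a = 1 - (1 / real q) ^ r"
  from exists_uncolourable_density_forced[OF assms(3) r] obtain F' where
    F': "k_graph r F'" "forces r 0 (1 - real q * (1 / real q) ^ r) F'" "uncolourable q F'" by blast
  from exists_uncolourable_degree_forced[OF F' assms(3) r, of l] obtain F where
    F: "k_graph k F" "forces k l a F" "uncolourable q F"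
    unfolding a_def k by blast
  have "edges F \<noteq> {}"
    using F(3)[unfolded uncolourable_def, rule_format, of "\<lambda>_. 0"] assms(3) by auto
  have pos: "\<forall>\<^sub>F n in sequentially. real ((n - l) choose r) > 0"
    using eventually_ge_at_top[of k] by eventually_elim (auto simp: k)
  have "degree_ratio k l F \<longlonglongrightarrow> a"
  proof (rule order_tendstoI)
    fix b assume b: "b < a"
    have "(\<lambda>n. 1 - real ((n div q + 1) choose r) / real ((n - l) choose r)) \<longlonglongrightarrow> 1 - (1 / real q) ^ r"
      by (intro tendsto_intros choose_ratio_tendsto block_ratio_tendsto shift_ratio_tendsto assms)
    then have "\<forall>\<^sub>F n in sequentially. b < 1 - real ((n div q + 1) choose r) / real ((n - l) choose r)"
      using b unfolding a_def by (rule order_tendstoD)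
    then show "\<forall>\<^sub>F n in sequentially. b < degree_ratio k l F n"
      using pos eventually_ge_at_top[of l]
    proof eventually_elim
      fix n
      assume *: "b < 1 - real ((n div q + 1) choose r) / real ((n - l) choose r)"
        and p: "real ((n - l) choose r) > 0" and n: "l \<le> n"
      have "real ((n - l) choose r) \<le> real (ex_degree k l n F) + real ((n div q + 1) choose r)"
        using ex_degree_lower[OF F(3) assms(3) n assms(2,1)]
        by (simp only: r_def of_nat_le_iff flip: of_nat_add)
      then have "1 - real ((n div q + 1) choose r) / real ((n - l) choose r) \<le> degree_ratio k l F n"
        unfolding degree_ratio_def r_def[symmetric] by (subst le_divide_eq) (use p in \<open>simp add: left_diff_distrib\<close>)
      with * show "b < degree_ratio k l F n" by linarith
    qed
  next
    fix b assume b: "a < b"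
    then have "b - a > 0" by simp
    from ex_degree_upper[OF F(2,3) assms(3) this] pos
    show "\<forall>\<^sub>F n in sequentially. degree_ratio k l F n < b"
      by eventually_elim (simp add: degree_ratio_def r_def[symmetric] field_simps)
  qed
  moreover have "a = 1 - real q powi (int l - int k)"
    using assms by (simp add: a_def k power_int_minus power_one_over inverse_eq_divide)
  ultimately show ?thesis
    using F(1) \<open>edges F \<noteq> {}\<close> unfolding convergent_def turan_density_def
    by (intro exI[of _ F]) (auto dest: limI)
qed

end
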